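(* Let $n \ge 1$, $d = 2^n$, and let $\Phi$ be an (unknown) quantum channel on an $n$-qubit system with Pauli transfer matrix $\Gamma$. For $0 \le i,j \le d^2-1$ let $\|\Gamma_{ij}\|_D$ and $\|\Gamma_{ij}\|_Q$ be the number of experimental configurations required to reconstruct the entry $\Gamma_{ij}$ using DPTM and sQPT respectively (as defined in the context). Then $$\max_{i,j}\|\Gamma_{ij}\|_D \le \min_{i,j}\|\Gamma_{ij}\|_Q < \max_{i,j}\|\Gamma_{ij}\|_Q ,$$ where equality in the first relation is satisfied only for $n=1$. Indeed, $$\|\Gamma_{ij}\|_D = \begin{cases} 1 & \text{for } j = 0,\\ 2 & \text{for } j \ne 0,\end{cases}$$ while $$\min_{i,j}\|\Gamma_{ij}\|_Q = 2^n, \qquad \max_{i,j}\|\Gamma_{ij}\|_Q = 3^n .$$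
   Context: Pauli basis: let $\sigma_0 = I_2$, $\sigma_1 = X$, $\sigma_2 = Y$, $\sigma_3 = Z$ be the $2\times 2$ identity and Pauli matrices. For $n$ qubits, $d=2^n$, the Pauli basis $\{\mathcal{P}_k : k=0,\dots,d^2-1\}$ consists of the operators $\sigma_{\alpha_1}\otimes\cdots\otimes\sigma_{\alpha_n}$ with $\alpha_1,\dots,\alpha_n\in\{0,1,2,3\}$, in lexicographic order (so $\mathcal{P}_0 = I$, the $d \times d$ identity). A quantum channel is a linear completely positive trace-preserving map $\Phi$ on $d\times d$ complex matrices. Its Pauli transfer matrix (PTM) is the $d^2\times d^2$ matrix $\Gamma_{ij} = \frac1d \mathrm{Tr}[\mathcal{P}_i\Phi(\mathcal{P}_j)]$. Reconstruction from a set of input states: let $\{\tau_j\}_{0\le j\le d^2-1}$ be input states (density matrices) forming a basis of the space of $d\times d$ matrices. An experimental configuration is a pair consisting of an input state $\tau_j$ and an output Pauli measurement $\mathcal{P}_i$, with outcome $M_{ij} = \mathrm{Tr}[\mathcal{P}_i\Phi(\tau_j)]$. Put $\beta_{ij} = \mathrm{Tr}[\mathcal{P}_i\tau_j]$, an invertible $d^2\times d^2$ matrix. Then $M=\Gamma\beta$, so the PTM is reconstructed as $\Gamma = M\beta^{-1}$, i.e. $\Gamma_{ij} = \sum_k M_{ik}(\beta^{-1})_{kj}$. The number of experimental configurations required to reconstruct $\Gamma_{ij}$ is the number of configurations $M_{ik}$ appearing with nonzero coefficient in this formula, i.e. the number of indices $k$ with $(\beta^{-1})_{kj}\neq 0$.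 DPTM (direct PTM reconstruction): the input states are $\rho_0 = I/d$ and $\rho_k = (I+\mathcal{P}_k)/d$ for $1 \le k \le d^2-1$. The corresponding cost is denoted $\|\Gamma_{ij}\|_D$. sQPT (standard quantum process tomography): for one qubit the input states are $\rho^Q_0 = |1\rangle\langle 1|$, $\rho^Q_1 = |+\rangle\langle +|$, $\rho^Q_2 = |i\rangle\langle i|$, $\rho^Q_3 = |0\rangle\langle 0|$, where $|+\rangle = (|0\rangle+|1\rangle)/\sqrt2$ and $|i\rangle = (|0\rangle + i|1\rangle)/\sqrt2$. For $n$ qubits the input states are all $n$-fold Kronecker products $\rho^Q_{\alpha_1}\otimes\cdots\otimes\rho^Q_{\alpha_n}$, $\alpha_1,\dots,\alpha_n\in\{0,1,2,3\}$, in lexicographic order. Hence the matrix $\beta$ for $n$ qubits is $(\beta_Q)^{\otimes n}$, where $\beta_Q$ is the one-qubit matrix $(\beta_Q)_{ij} = \mathrm{Tr}[\sigma_i\rho^Q_j]$. The corresponding cost is denoted $\|\Gamma_{ij}\|_Q$. *)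

theory Defs
  imports
    "Jordan_Normal_Form.Matrix"
    "Jordan_Normal_Form.Gauss_Jordan_Elimination"
begin

definition mat_trace :: "'a::comm_monoid_add mat \<Rightarrow> 'a" where
  "mat_trace A = (\<Sum>i<dim_row A. A $$ (i, i))"

definition kronecker :: "'a::times mat \<Rightarrow> 'a mat \<Rightarrow> 'a mat"  (infixr "\<otimes>\<^sub>m" 72) where
  "A \<otimes>\<^sub>m B = mat (dim_row A * dim_row B) (dim_col A * dim_col B)
     (\<lambda>(i, j). A $$ (i div dim_row B, j div dim_col B) * B $$ (i mod dim_row B, j mod dim_col B))"

text \<open>The index \<open>k < 4 ^ n\<close> encodes the multi-index \<open>\<alpha>\<^sub>1, \<dots>, \<alpha>\<^sub>n\<close> of its base-4 digits, most
  significant digit first; the usual order of the \<open>k\<close> is the lexicographic order of the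
  multi-indices.\<close>

definition multi_index :: "nat \<Rightarrow> nat \<Rightarrow> nat list" where
  "multi_index n k = map (\<lambda>l. k div 4 ^ (n - Suc l) mod 4) [0..<n]"

definition kron_family :: "(nat \<Rightarrow> 'a::semiring_1 mat) \<Rightarrow> nat \<Rightarrow> nat \<Rightarrow> 'a mat" where
  "kron_family A n k = foldr (\<otimes>\<^sub>m) (map A (multi_index n k)) (1\<^sub>m 1)"

definition sigma :: "nat \<Rightarrow> complex mat" where
  "sigma a =
    [1\<^sub>m 2,
     mat_of_rows_list 2 [[0, 1], [1, 0]],
     mat_of_rows_list 2 [[0, - \<i>], [\<i>, 0]],
     mat_of_rows_list 2 [[1, 0], [0, - 1]]] ! a"

definition pauli :: "nat \<Rightarrow> nat \<Rightarrow> complex mat" where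
  "pauli n k = kron_family sigma n k"

definition positive_semidef :: "nat \<Rightarrow> complex mat \<Rightarrow> bool" where
  "positive_semidef m A \<longleftrightarrow>
     A \<in> carrier_mat m m \<and> (\<forall>v\<in>carrier_vec m. 0 \<le> (A *\<^sub>v v) \<bullet>c v)"

definition linear_on_mats :: "nat \<Rightarrow> (complex mat \<Rightarrow> complex mat) \<Rightarrow> bool" where
  "linear_on_mats d \<Phi> \<longleftrightarrow>
     (\<forall>A\<in>carrier_mat d d. \<Phi> A \<in> carrier_mat d d) \<and>
     (\<forall>A\<in>carrier_mat d d. \<forall>B\<in>carrier_mat d d. \<Phi> (A + B) = \<Phi> A + \<Phi> B) \<and>
     (\<forall>c. \<forall>A\<in>carrier_mat d d. \<Phi> (c \<cdot>\<^sub>m A) = c \<cdot>\<^sub>m \<Phi> A)"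

text \<open>An \<open>m * d\<close> by \<open>m * d\<close> matrix is read as an \<open>m\<close> by \<open>m\<close> array of \<open>d\<close> by \<open>d\<close> blocks;
  \<open>id \<otimes> \<Phi>\<close> acts on each block.\<close>

definition mat_block :: "nat \<Rightarrow> nat \<Rightarrow> nat \<Rightarrow> 'a mat \<Rightarrow> 'a mat" where
  "mat_block d a b A = mat d d (\<lambda>(r, s). A $$ (a * d + r, b * d + s))"

definition id_tensor_map :: "nat \<Rightarrow> nat \<Rightarrow> (complex mat \<Rightarrow> complex mat) \<Rightarrow> complex mat \<Rightarrow> complex mat"
  where
  "id_tensor_map m d \<Phi> A =
     mat (m * d) (m * d) (\<lambda>(i, j). \<Phi> (mat_block d (i div d) (j div d) A) $$ (i mod d, j mod d))"

definition completely_positive :: "nat \<Rightarrow> (complex mat \<Rightarrow> complex mat) \<Rightarrow> bool" where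
  "completely_positive d \<Phi> \<longleftrightarrow>
     (\<forall>m A. positive_semidef (m * d) A \<longrightarrow> positive_semidef (m * d) (id_tensor_map m d \<Phi> A))"

definition trace_preserving :: "nat \<Rightarrow> (complex mat \<Rightarrow> complex mat) \<Rightarrow> bool" where
  "trace_preserving d \<Phi> \<longleftrightarrow> (\<forall>A\<in>carrier_mat d d. mat_trace (\<Phi> A) = mat_trace A)"

definition quantum_channel :: "nat \<Rightarrow> (complex mat \<Rightarrow> complex mat) \<Rightarrow> bool" where
  "quantum_channel d \<Phi> \<longleftrightarrow>
     linear_on_mats d \<Phi> \<and> completely_positive d \<Phi> \<and> trace_preserving d \<Phi>"

definition ptm :: "nat \<Rightarrow> (complex mat \<Rightarrow> complex mat) \<Rightarrow> complex mat" where
  "ptm n \<Phi> = mat ((2 ^ n)\<^sup>2) ((2 ^ n)\<^sup>2)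
     (\<lambda>(i, j). 1 / 2 ^ n * mat_trace (pauli n i * \<Phi> (pauli n j)))"

definition beta :: "nat \<Rightarrow> (nat \<Rightarrow> complex mat) \<Rightarrow> complex mat" where
  "beta n \<tau> = mat ((2 ^ n)\<^sup>2) ((2 ^ n)\<^sup>2) (\<lambda>(i, j). mat_trace (pauli n i * \<tau> j))"

definition beta_inv :: "nat \<Rightarrow> (nat \<Rightarrow> complex mat) \<Rightarrow> complex mat" where
  "beta_inv n \<tau> = the (mat_inverse (beta n \<tau>))"

text \<open>The pair \<open>(i, k)\<close> stands for the experimental configuration with input state \<open>\<tau> k\<close> and output
  measurement \<open>pauli n i\<close>, whose outcome is \<open>M i k = mat_trace (pauli n i * \<Phi> (\<tau> k))\<close>. Since
  \<open>M = ptm n \<Phi> * beta n \<tau>\<close>, the \<open>(i, j)\<close> entry of \<open>ptm n \<Phi>\<close> is reconstructed as the sum over \<open>k\<close> of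
  \<open>M i k * beta_inv n \<tau> $$ (k, j)\<close>; the configurations with nonzero coefficient are counted.\<close>

definition required_configs :: "nat \<Rightarrow> (nat \<Rightarrow> complex mat) \<Rightarrow> nat \<Rightarrow> nat \<Rightarrow> (nat \<times> nat) set" where
  "required_configs n \<tau> i j = {(i, k) | k. k < (2 ^ n)\<^sup>2 \<and> beta_inv n \<tau> $$ (k, j) \<noteq> 0}"

definition reconstruction_cost :: "nat \<Rightarrow> (nat \<Rightarrow> complex mat) \<Rightarrow> nat \<Rightarrow> nat \<Rightarrow> nat" where
  "reconstruction_cost n \<tau> i j = card (required_configs n \<tau> i j)"

definition dptm_state :: "nat \<Rightarrow> nat \<Rightarrow> complex mat" where
  "dptm_state n k =
     (if k = 0 then (1 / 2 ^ n) \<cdot>\<^sub>m 1\<^sub>m (2 ^ n)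
      else (1 / 2 ^ n) \<cdot>\<^sub>m (1\<^sub>m (2 ^ n) + pauli n k))"

definition projector :: "complex vec \<Rightarrow> complex mat" where
  "projector v = mat (dim_vec v) (dim_vec v) (\<lambda>(i, j). v $ i * cnj (v $ j))"

definition ket0 :: "complex vec" where "ket0 = vec_of_list [1, 0]"

definition ket1 :: "complex vec" where "ket1 = vec_of_list [0, 1]"

definition ket_plus :: "complex vec" where
  "ket_plus = (1 / complex_of_real (sqrt 2)) \<cdot>\<^sub>v (ket0 + ket1)"

definition ket_i :: "complex vec" where
  "ket_i = (1 / complex_of_real (sqrt 2)) \<cdot>\<^sub>v (ket0 + \<i> \<cdot>\<^sub>v ket1)"

definition sqpt_state1 :: "nat \<Rightarrow> complex mat" where
  "sqpt_state1 a = [projector ket1, projector ket_plus, projector ket_i, projector ket0] ! a"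

definition sqpt_state :: "nat \<Rightarrow> nat \<Rightarrow> complex mat" where
  "sqpt_state n k = kron_family sqpt_state1 n k"

definition dptm_cost :: "nat \<Rightarrow> nat \<Rightarrow> nat \<Rightarrow> nat" where
  "dptm_cost n i j = reconstruction_cost n (dptm_state n) i j"

definition sqpt_cost :: "nat \<Rightarrow> nat \<Rightarrow> nat \<Rightarrow> nat" where
  "sqpt_cost n i j = reconstruction_cost n (sqpt_state n) i j"

end

(* The entries of beta are traces of products of Kronecker products, so they factor over the base-4
   digits of the indices. By orthogonality of the Pauli basis, beta for DPTM is the identity plus a
   first row of ones, and its inverse is the identity minus that row. For sQPT, beta and hence its
   inverse are n-th Kronecker powers, so the nonzero entries in column j of the inverse are counted
   by the product over the digits of j of the counts 2, 3, 3, 2 for the four columns of the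
   one-qubit inverse. *)

theory Submission
  imports Defs "Jordan_Normal_Form.Determinant"
begin

section \<open>Sums over base-4 digits\<close>

text \<open>The range below \<open>m * n\<close> is cut into \<open>m\<close> consecutive blocks of
  length \<open>n\<close>; the quotient numbers the block and the remainder the place in it.\<close>

lemma sum_div_mod:
  fixes f :: "nat \<Rightarrow> nat \<Rightarrow> 'a::comm_monoid_add"
  shows "(\<Sum>i<m * n. f (i div n) (i mod n)) = (\<Sum>a<m. \<Sum>b<n. f a b)"
proof -
  have "(\<Sum>i<m * n. f (i div n) (i mod n)) = (\<Sum>a<m. \<Sum>i=a * n..<a * n + n. f (i div n) (i mod n))"
    by (rule sum.nat_group[symmetric])
  also have "\<dots> = (\<Sum>a<m. \<Sum>b<n. f a b)"
  proof (rule sum.cong[OF refl])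
    fix a
    have "(\<Sum>i=a * n..<a * n + n. f (i div n) (i mod n))
        = (\<Sum>b=0..<n. f ((b + a * n) div n) ((b + a * n) mod n))"
      using sum.shift_bounds_nat_ivl[of "\<lambda>i. f (i div n) (i mod n)" 0 "a * n" n]
      by (simp add: add.commute)
    also have "\<dots> = (\<Sum>b<n. f a b)"
      unfolding atLeast0LessThan by (rule sum.cong) auto
    finally show "(\<Sum>i=a * n..<a * n + n. f (i div n) (i mod n)) = (\<Sum>b<n. f a b)" .
  qed
  finally show ?thesis .
qed

text \<open>Reduction modulo \<open>4 ^ n\<close> discards only the digits at positions
  \<open>n\<close> and above.\<close>

lemma digit_mod: "l < n \<Longrightarrow> k mod 4 ^ n div 4 ^ l mod 4 = k div 4 ^ l mod (4::nat)"
proof -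
  assume "l < n"
  then obtain e where n: "n = l + Suc e" using less_imp_Suc_add by fastforce
  have "k mod 4 ^ n div 4 ^ l = k div 4 ^ l mod (4 * 4 ^ e)"
    unfolding n power_add by (simp add: mod_mult2_eq)
  then show ?thesis by (simp add: mod_mod_cancel)
qed

text \<open>As \<open>k\<close> runs below \<open>4 ^ n\<close>, its digits run independently
  through all \<open>n\<close>-tuples, so this is distributivity. It serves twice for sQPT: to
  verify the inverse of \<open>beta\<close> and to count its nonzero entries.\<close>

lemma sum_prod_digits:
  fixes f :: "nat \<Rightarrow> nat \<Rightarrow> 'a::comm_semiring_1"
  shows "(\<Sum>k<4 ^ n. \<Prod>l<n. f l (k div 4 ^ l mod 4)) = (\<Prod>l<n. \<Sum>a<4. f l a)"
proof (induction n)
  case (Suc n)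
  have "(\<Sum>k<4 ^ Suc n. \<Prod>l<Suc n. f l (k div 4 ^ l mod 4))
      = (\<Sum>k<4 * 4 ^ n. (\<Prod>l<n. f l (k mod 4 ^ n div 4 ^ l mod 4)) * f n (k div 4 ^ n))"
    by (intro sum.cong) (auto simp: digit_mod less_mult_imp_div_less)
  also have "\<dots> = (\<Sum>a<4. \<Sum>k<4 ^ n. (\<Prod>l<n. f l (k div 4 ^ l mod 4)) * f n a)"
    by (rule sum_div_mod)
  also have "\<dots> = (\<Prod>l<Suc n. \<Sum>a<4. f l a)"
    by (simp only: sum_distrib_right[symmetric] sum_distrib_left[symmetric] Suc.IH prod.lessThan_Suc)
  finally show ?case .
qed simp

lemma mod_eq_of_digits_eq:
  "(\<And>l. l < n \<Longrightarrow> i div 4 ^ l mod 4 = j div 4 ^ l mod (4::nat)) \<Longrightarrow> i mod 4 ^ n = j mod 4 ^ n"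
proof (induction n)
  case (Suc n)
  have "i mod (4 ^ n * 4) = j mod (4 ^ n * 4)"
    unfolding mod_mult2_eq using Suc.IH Suc.prems by simp
  then show ?case by (simp add: mult.commute)
qed simp

lemma prod_digits_eq:
  fixes i j :: nat
  assumes "i < 4 ^ n" "j < 4 ^ n"
  shows "(\<Prod>l<n. of_bool (i div 4 ^ l mod 4 = j div 4 ^ l mod 4)) =
    (of_bool (i = j) :: 'a::comm_semiring_1)"
proof (cases "\<forall>l<n. i div 4 ^ l mod 4 = j div 4 ^ l mod 4")
  case True
  then have "i = j" using mod_eq_of_digits_eq[of n i j] assms by auto
  then show ?thesis by simp
next
  case False
  then have "(\<Prod>l<n. of_bool (i div 4 ^ l mod 4 = j div 4 ^ l mod 4)) = (0::'a)"
    by (intro prod_zero) auto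
  then show ?thesis using False by auto
qed

text \<open>Such an index attains the sQPT maximum, since column 1 of the one-qubit inverse has
  three nonzero entries.\<close>

lemma ex_all_digits_1: "\<exists>j<4 ^ n. \<forall>l<n. j div 4 ^ l mod 4 = (1::nat)"
proof (induction n)
  case (Suc n)
  then obtain j :: nat where j: "j < 4 ^ n" "\<forall>l<n. j div 4 ^ l mod 4 = 1" by blast
  \<comment> \<open>Adding \<open>4 ^ n\<close> puts one more digit 1 in front of
    \<open>j\<close>.\<close>
  have "(4 ^ n + j) div 4 ^ l mod 4 = 1" if "l < Suc n" for l
  proof (cases "l = n")
    case False
    then show ?thesis using that j digit_mod[of l n "4 ^ n + j"] by simp
  qed (use j in simp)
  moreover have "4 ^ n + j < 4 ^ Suc n" using j by simp
  ultimately show ?case by blast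
qed simp

lemma sum_lessThan_4: "sum f {..<4::nat} = f 0 + f 1 + f 2 + (f 3 :: 'a::comm_monoid_add)"
  by (simp add: numeral_eq_Suc add.assoc)

lemma less_4_cases: "(a::nat) < 4 \<Longrightarrow> a = 0 \<or> a = 1 \<or> a = 2 \<or> a = 3"
  by auto

section \<open>Traces of Kronecker products\<close>

lemma mat_trace_mult:
  fixes A B :: "'a::comm_semiring_0 mat"
  assumes "A \<in> carrier_mat r c" "B \<in> carrier_mat c r"
  shows "mat_trace (A * B) = (\<Sum>i<r. \<Sum>j<c. A $$ (i, j) * B $$ (j, i))"
  using assms unfolding mat_trace_def
  by (auto simp: scalar_prod_def atLeast0LessThan intro!: sum.cong)

lemma kronecker_carrier [intro]:
  "A \<in> carrier_mat r c \<Longrightarrow> B \<in> carrier_mat r' c' \<Longrightarrow> A \<otimes>\<^sub>m B \<in> carrier_mat (r * r') (c * c')"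
  unfolding kronecker_def by auto

lemma kronecker_index:
  assumes "A \<in> carrier_mat r c" "B \<in> carrier_mat r' c'" "i < r * r'" "j < c * c'"
  shows "(A \<otimes>\<^sub>m B) $$ (i, j) = A $$ (i div r', j div c') * B $$ (i mod r', j mod c')"
  using assms unfolding kronecker_def by auto

lemma kronecker_one: "1\<^sub>m m \<otimes>\<^sub>m 1\<^sub>m n = (1\<^sub>m (m * n) :: 'a::semiring_1 mat)"
proof (rule eq_matI)
  fix i j assume "i < dim_row (1\<^sub>m (m * n) :: 'a mat)" "j < dim_col (1\<^sub>m (m * n) :: 'a mat)"
  then have ij: "i < m * n" "j < m * n" by auto
  then have "n > 0" by (cases n) auto
  have eq: "i = j \<longleftrightarrow> i div n = j div n \<and> i mod n = j mod n"
    by (metis div_mult_mod_eq)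
  show "(1\<^sub>m m \<otimes>\<^sub>m 1\<^sub>m n) $$ (i, j) = (1\<^sub>m (m * n) :: 'a mat) $$ (i, j)"
    using ij \<open>n > 0\<close> eq
    by (auto simp: kronecker_index[OF one_carrier_mat one_carrier_mat ij] less_mult_imp_div_less)
qed (auto simp: kronecker_def)

text \<open>Splitting both the row and the column index into quotient and remainder turns the trace
  into a fourfold sum, which factors.\<close>

lemma mat_trace_kronecker:
  fixes A B C D :: "'a::comm_semiring_0 mat"
  assumes A: "A \<in> carrier_mat r c" and B: "B \<in> carrier_mat r' c'"
    and C: "C \<in> carrier_mat c r" and D: "D \<in> carrier_mat c' r'"
  shows "mat_trace ((A \<otimes>\<^sub>m B) * (C \<otimes>\<^sub>m D)) = mat_trace (A * C) * mat_trace (B * D)"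
proof -
  let ?g = "\<lambda>a b a' b'. A $$ (a, a') * B $$ (b, b') * (C $$ (a', a) * D $$ (b', b))"
  have "mat_trace ((A \<otimes>\<^sub>m B) * (C \<otimes>\<^sub>m D)) =
      (\<Sum>i<r * r'. \<Sum>j<c * c'. ?g (i div r') (i mod r') (j div c') (j mod c'))"
    using A B C D
    by (simp add: mat_trace_mult[OF kronecker_carrier[OF A B] kronecker_carrier[OF C D]]
        kronecker_index[OF A B] kronecker_index[OF C D])
  also have "\<dots> = (\<Sum>i<r * r'. \<Sum>a'<c. \<Sum>b'<c'. ?g (i div r') (i mod r') a' b')"
    by (intro sum.cong refl sum_div_mod)
  also have "\<dots> = (\<Sum>a<r. \<Sum>b<r'. \<Sum>a'<c. \<Sum>b'<c'. ?g a b a' b')"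
    by (rule sum_div_mod)
  also have "\<dots> = mat_trace (A * C) * mat_trace (B * D)"
    unfolding mat_trace_mult[OF A C] mat_trace_mult[OF B D]
    by (simp add: sum_product mult_ac)
  finally show ?thesis .
qed

lemma kron_family_0: "kron_family A 0 k = 1\<^sub>m 1"
  unfolding kron_family_def multi_index_def by simp

text \<open>The leftmost factor belongs to the most significant digit. The index \<open>k\<close> is
  passed on unreduced, because \<open>multi_index n\<close> reads only its \<open>n\<close> lowest
  digits.\<close>

lemma kron_family_Suc:
  "kron_family A (Suc n) k = A (k div 4 ^ n mod 4) \<otimes>\<^sub>m kron_family A n k"
  unfolding kron_family_def multi_index_def upt_conv_Cons[OF zero_less_Suc] map_Suc_upt[symmetric]
  by (simp add: comp_def)

lemma kron_family_carrier:
  assumes "\<And>a. a < 4 \<Longrightarrow> A a \<in> carrier_mat r c"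
  shows "kron_family A n k \<in> carrier_mat (r ^ n) (c ^ n)"
  by (induction n) (auto simp: kron_family_0 kron_family_Suc intro!: kronecker_carrier assms)

lemma mat_trace_kron_family:
  fixes A B :: "nat \<Rightarrow> 'a::comm_semiring_1 mat"
  assumes A: "\<And>a. a < 4 \<Longrightarrow> A a \<in> carrier_mat r c" and B: "\<And>a. a < 4 \<Longrightarrow> B a \<in> carrier_mat c r"
  shows "mat_trace (kron_family A n i * kron_family B n j) =
    (\<Prod>l<n. mat_trace (A (i div 4 ^ l mod 4) * B (j div 4 ^ l mod 4)))"
proof (induction n)
  case 0
  then show ?case by (simp add: kron_family_0 mat_trace_def)
next
  case (Suc n)
  then show ?case
    by (simp add: kron_family_Suc mult.commute
        mat_trace_kronecker[OF A kron_family_carrier[of A, OF A] B kron_family_carrier[of B, OF B]])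
qed

section \<open>The Pauli basis\<close>

lemma sigma_carrier: "a < 4 \<Longrightarrow> sigma a \<in> carrier_mat 2 2"
  by (auto dest!: less_4_cases simp: sigma_def mat_of_rows_list_def)

lemma pauli_carrier: "pauli n k \<in> carrier_mat (2 ^ n) (2 ^ n)"
  unfolding pauli_def by (rule kron_family_carrier) (rule sigma_carrier)

lemma pauli_0: "pauli n 0 = 1\<^sub>m (2 ^ n)"
  unfolding pauli_def
  by (induction n) (simp_all add: kron_family_0 kron_family_Suc kronecker_one sigma_def)

lemma sigma_orthogonal:
  assumes "a < 4" "b < 4"
  shows "mat_trace (sigma a * sigma b) = 2 * of_bool (a = b)"
  unfolding mat_trace_mult[OF sigma_carrier[OF assms(1)] sigma_carrier[OF assms(2)]]
  using less_4_cases[OF assms(1)] less_4_cases[OF assms(2)]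
  by (elim disjE) (simp_all add: sigma_def mat_of_rows_list_def numeral_2_eq_2)

lemma pauli_orthogonal:
  assumes "i < 4 ^ n" "j < 4 ^ n"
  shows "mat_trace (pauli n i * pauli n j) = 2 ^ n * of_bool (i = j)"
  unfolding pauli_def
  by (simp add: mat_trace_kron_family[of sigma 2 2 sigma, OF sigma_carrier sigma_carrier]
      sigma_orthogonal prod.distrib prod_digits_eq[OF assms])

section \<open>Reconstruction costs\<close>

lemma square_power_2: "(2 ^ n)\<^sup>2 = (4::nat) ^ n"
  by (simp add: power_mult_distrib[symmetric] power2_eq_square)

text \<open>For square matrices over a field a right inverse is also a left inverse, and inverses
  are unique.\<close>

lemma beta_inv_eqI:
  assumes G: "G \<in> carrier_mat (4 ^ n) (4 ^ n)" and inv: "beta n \<tau> * G = 1\<^sub>m (4 ^ n)"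
  shows "beta_inv n \<tau> = G"
proof -
  have b: "beta n \<tau> \<in> carrier_mat (4 ^ n) (4 ^ n)"
    by (simp add: beta_def square_power_2)
  have inv': "G * beta n \<tau> = 1\<^sub>m (4 ^ n)"
    by (rule mat_mult_left_right_inverse[OF b G inv])
  \<comment> \<open>Invertibility excludes the result \<open>None\<close>, so that
    \<open>the\<close> in \<open>beta_inv\<close> yields a genuine inverse.\<close>
  have "beta n \<tau> \<in> Units (ring_mat TYPE(complex) (4 ^ n) ())"
    using b G inv inv' unfolding Units_def ring_mat_def by auto
  then obtain H where H: "mat_inverse (beta n \<tau>) = Some H"
    using mat_inverse(1)[OF b, of "()"] by (cases "mat_inverse (beta n \<tau>)") auto
  have "H * beta n \<tau> = 1\<^sub>m (4 ^ n)" "H \<in> carrier_mat (4 ^ n) (4 ^ n)"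
    using mat_inverse(2)[OF b H] by auto
  then have "H = G"
    using G b inv by (metis assoc_mult_mat left_mult_one_mat right_mult_one_mat)
  then show ?thesis by (simp add: beta_inv_def H)
qed

lemma beta_inv_matI:
  assumes "\<And>i j. i < 4 ^ n \<Longrightarrow> j < 4 ^ n \<Longrightarrow>
      (\<Sum>k<4 ^ n. mat_trace (pauli n i * \<tau> k) * g k j) = of_bool (i = j)"
  shows "beta_inv n \<tau> = mat (4 ^ n) (4 ^ n) (\<lambda>(i, j). g i j)"
  by (rule beta_inv_eqI; (rule eq_matI)?)
    (auto simp: beta_def square_power_2 scalar_prod_def atLeast0LessThan assms)

text \<open>The row index is only a tag on each configuration, attached by the injective map
  \<open>Pair i\<close>; the cost depends on the column alone.\<close>

lemma reconstruction_cost_eq: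
  assumes "beta_inv n \<tau> = mat (4 ^ n) (4 ^ n) (\<lambda>(i, j). g i j)" "j < 4 ^ n"
  shows "reconstruction_cost n \<tau> i j = card {k. k < 4 ^ n \<and> g k j \<noteq> 0}"
proof -
  have "required_configs n \<tau> i j = Pair i ` {k. k < 4 ^ n \<and> g k j \<noteq> 0}"
    unfolding required_configs_def assms(1) square_power_2 using assms(2) by auto
  then show ?thesis
    unfolding reconstruction_cost_def by (simp add: card_image inj_on_def)
qed

section \<open>Cost of DPTM\<close>

lemma mat_trace_pauli_dptm_state:
  assumes "i < 4 ^ n" "k < 4 ^ n"
  shows "mat_trace (pauli n i * dptm_state n k) = of_bool (i = k) + of_bool (i = 0 \<and> k \<noteq> 0)"
proof -
  note P = pauli_carrier[of n]
  have tr_smult: "mat_trace (c \<cdot>\<^sub>m A) = c * mat_trace A" if "A \<in> carrier_mat m m"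
    for c :: complex and A m
    using that by (simp add: mat_trace_def sum_distrib_left)
  have tr_add: "mat_trace (A + B) = mat_trace A + mat_trace B"
    if "A \<in> carrier_mat m m" "B \<in> carrier_mat m m" for A B :: "complex mat" and m
    using that by (simp add: mat_trace_def sum.distrib)
  \<comment> \<open>The identity in the input states is treated as \<open>pauli n 0\<close>, so that
    orthogonality covers it as well.\<close>
  have one: "mat_trace (pauli n i * pauli n 0) = 2 ^ n * of_bool (i = 0)"
    using assms by (simp add: pauli_orthogonal)
  show ?thesis
  proof (cases "k = 0")
    case True
    then show ?thesis using one
      by (simp add: dptm_state_def pauli_0[symmetric] mult_smult_distrib[OF P P]
          tr_smult[OF mult_carrier_mat[OF P P]])
  next
    case False
    have "mat_trace (pauli n i * dptm_state n k)
        = 1 / 2 ^ n * (mat_trace (pauli n i * pauli n 0) + mat_trace (pauli n i * pauli n k))"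
      using False
      by (simp add: dptm_state_def pauli_0[symmetric] mult_smult_distrib[OF P add_carrier_mat[OF P]]
          mult_add_distrib_mat[OF P P P] tr_smult[OF add_carrier_mat[OF mult_carrier_mat[OF P P]]]
          tr_add[OF mult_carrier_mat[OF P P] mult_carrier_mat[OF P P]])
    then show ?thesis using False
      by (simp add: one pauli_orthogonal[OF assms] distrib_left)
  qed
qed

lemma dptm_cost_eq:
  assumes j: "j < 4 ^ n"
  shows "dptm_cost n i j = (if j = 0 then 1 else 2)"
proof -
  \<comment> \<open>Here \<open>beta\<close> is the identity plus a matrix \<open>N\<close> with
    ones in row 0 outside column 0. As \<open>N\<close> squares to zero, the inverse is the identity
    minus \<open>N\<close>.\<close>
  define g :: "nat \<Rightarrow> nat \<Rightarrow> complex"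
    where "g k j = of_bool (k = j) - of_bool (k = 0 \<and> j \<noteq> 0)" for k j
  have "beta_inv n (dptm_state n) = mat (4 ^ n) (4 ^ n) (\<lambda>(i, j). g i j)"
  proof (rule beta_inv_matI)
    fix i j :: nat assume ij: "i < 4 ^ n" "j < 4 ^ n"
    have "(\<Sum>k<4 ^ n. mat_trace (pauli n i * dptm_state n k) * g k j)
        = (\<Sum>k<4 ^ n. (if k = j then of_bool (i = j) + of_bool (i = 0 \<and> j \<noteq> 0) else 0)
            - (if k = 0 then of_bool (i = 0 \<and> j \<noteq> 0) else 0))"
      by (rule sum.cong) (auto simp: mat_trace_pauli_dptm_state[OF ij(1)] g_def)
    also have "\<dots> = of_bool (i = j)"
      unfolding sum_subtractf using ij by simp
    finally show "(\<Sum>k<4 ^ n. mat_trace (pauli n i * dptm_state n k) * g k j) = of_bool (i = j)" .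
  qed
  then have "dptm_cost n i j = card {k. k < 4 ^ n \<and> g k j \<noteq> 0}"
    unfolding dptm_cost_def by (rule reconstruction_cost_eq[OF _ j])
  \<comment> \<open>For \<open>j = 0\<close> the two elements coincide, which gives the exceptional
    cost 1.\<close>
  also have "{k. k < 4 ^ n \<and> g k j \<noteq> 0} = {0, j}"
    using j by (auto simp: g_def split: if_splits)
  finally show ?thesis by auto
qed

section \<open>Cost of sQPT\<close>

lemma sqpt_state1_carrier: "a < 4 \<Longrightarrow> sqpt_state1 a \<in> carrier_mat 2 2"
  by (auto dest!: less_4_cases
      simp: sqpt_state1_def projector_def ket0_def ket1_def ket_plus_def ket_i_def)

text \<open>Column \<open>b\<close> holds the trace and the three Bloch coordinates of the
  \<open>b\<close>-th one-qubit input state.\<close>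

definition sqpt_beta1 :: "nat \<Rightarrow> nat \<Rightarrow> complex" where
  "sqpt_beta1 a b = [[1, 1, 1, 1], [0, 1, 0, 0], [0, 0, 1, 0], [-1, 0, 0, 1]] ! a ! b"

text \<open>Column \<open>b\<close> expands \<open>sigma b\<close> divided by 2 in the four input
  states. The identity and Z need only the two computational basis states; X and Y need a third
  state.\<close>

definition sqpt_beta1_inv :: "nat \<Rightarrow> nat \<Rightarrow> complex" where
  "sqpt_beta1_inv a b =
    [[1/2, -1/2, -1/2, -1/2], [0, 1, 0, 0], [0, 0, 1, 0], [1/2, -1/2, -1/2, 1/2]] ! a ! b"

lemma mat_trace_sigma_sqpt_state1:
  assumes "a < 4" "b < 4"
  shows "mat_trace (sigma a * sqpt_state1 b) = sqpt_beta1 a b"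
proof -
  \<comment> \<open>Each entry of the projectors onto \<open>ket_plus\<close> and
    \<open>ket_i\<close> contains the factor 1 / sqrt 2 twice.\<close>
  have half: "complex_of_real (sqrt 2) * complex_of_real (sqrt 2) = 2"
    by (simp flip: of_real_mult)
  show ?thesis
    unfolding mat_trace_mult[OF sigma_carrier[OF assms(1)] sqpt_state1_carrier[OF assms(2)]]
    using less_4_cases[OF assms(1)] less_4_cases[OF assms(2)]
    by (elim disjE) (simp_all add: sigma_def mat_of_rows_list_def numeral_2_eq_2
        sqpt_state1_def projector_def ket0_def ket1_def ket_plus_def ket_i_def
        sqpt_beta1_def half)
qed

lemma sqpt_beta1_inverse:
  assumes "a < 4" "b < 4"
  shows "(\<Sum>c<4. sqpt_beta1 a c * sqpt_beta1_inv c b) = of_bool (a = b)"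
  using less_4_cases[OF assms(1)] less_4_cases[OF assms(2)]
  by (elim disjE) (simp_all add: sum_lessThan_4 sqpt_beta1_def sqpt_beta1_inv_def)

lemma sqpt_beta1_inv_count:
  assumes "a < 4"
  shows "(\<Sum>c<4. of_bool (sqpt_beta1_inv c a \<noteq> 0)) = (if a = 0 \<or> a = 3 then 2 else 3 :: nat)"
  using less_4_cases[OF assms]
  by (elim disjE) (simp_all add: sum_lessThan_4 sqpt_beta1_inv_def)

lemma sqpt_cost_eq:
  assumes j: "j < 4 ^ n"
  shows "sqpt_cost n i j = (\<Prod>l<n. if j div 4 ^ l mod 4 = 0 \<or> j div 4 ^ l mod 4 = 3 then 2 else 3)"
proof -
  \<comment> \<open>These are the entries of the \<open>n\<close>-th Kronecker power of the
    one-qubit inverse.\<close>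
  define g where "g k j = (\<Prod>l<n. sqpt_beta1_inv (k div 4 ^ l mod 4) (j div 4 ^ l mod 4))" for k j
  have "beta_inv n (sqpt_state n) = mat (4 ^ n) (4 ^ n) (\<lambda>(i, j). g i j)"
  proof (rule beta_inv_matI)
    fix i j :: nat assume ij: "i < 4 ^ n" "j < 4 ^ n"
    have "(\<Sum>k<4 ^ n. mat_trace (pauli n i * sqpt_state n k) * g k j)
        = (\<Sum>k<4 ^ n. \<Prod>l<n. sqpt_beta1 (i div 4 ^ l mod 4) (k div 4 ^ l mod 4)
            * sqpt_beta1_inv (k div 4 ^ l mod 4) (j div 4 ^ l mod 4))"
      unfolding pauli_def sqpt_state_def g_def
      by (simp add: mat_trace_kron_family[of sigma 2 2 sqpt_state1, OF sigma_carrier sqpt_state1_carrier]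
          mat_trace_sigma_sqpt_state1 prod.distrib)
    also have "\<dots> = (\<Prod>l<n. of_bool (i div 4 ^ l mod 4 = j div 4 ^ l mod 4))"
      by (subst sum_prod_digits) (simp add: sqpt_beta1_inverse)
    also have "\<dots> = of_bool (i = j)"
      by (rule prod_digits_eq[OF ij])
    finally show "(\<Sum>k<4 ^ n. mat_trace (pauli n i * sqpt_state n k) * g k j) = of_bool (i = j)" .
  qed
  then have "sqpt_cost n i j = card {k. k < 4 ^ n \<and> g k j \<noteq> 0}"
    unfolding sqpt_cost_def by (rule reconstruction_cost_eq[OF _ j])
  also have "\<dots> = (\<Sum>k<4 ^ n. of_bool (g k j \<noteq> 0))"
    by (simp add: sum_of_bool_eq Int_def)
  \<comment> \<open>A product of complex numbers is nonzero exactly when every factor is, so the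
    indicator is a product over digits and \<open>sum_prod_digits\<close> applies again, now over
    the naturals.\<close>
  also have "\<dots> = (\<Sum>k<4 ^ n.
      \<Prod>l<n. of_bool (sqpt_beta1_inv (k div 4 ^ l mod 4) (j div 4 ^ l mod 4) \<noteq> 0))"
  proof (rule sum.cong[OF refl])
    fix k
    show "of_bool (g k j \<noteq> 0) =
        (\<Prod>l<n. of_bool (sqpt_beta1_inv (k div 4 ^ l mod 4) (j div 4 ^ l mod 4) \<noteq> 0) :: nat)"
    proof (cases "g k j = 0")
      case True
      then show ?thesis by (auto simp: g_def)
    next
      case False
      then show ?thesis by (simp add: g_def)
    qed
  qed
  also have "\<dots> = (\<Prod>l<n. if j div 4 ^ l mod 4 = 0 \<or> j div 4 ^ l mod 4 = 3 then 2 else 3)"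
    by (subst sum_prod_digits) (intro prod.cong refl sqpt_beta1_inv_count, simp)
  finally show ?thesis .
qed

section \<open>Extremal costs\<close>

lemma Min_sqpt_cost: "Min {sqpt_cost n i j | i j. i < 4 ^ n \<and> j < 4 ^ n} = 2 ^ n"
proof (rule Min_eqI)
  show "finite {sqpt_cost n i j | i j. i < 4 ^ n \<and> j < 4 ^ n}"
    by (rule finite_image_set2) auto
  have "2 ^ n \<le> sqpt_cost n i j" if "j < 4 ^ n" for i j
    unfolding sqpt_cost_eq[OF that]
    using prod_mono[of "{..<n}" "\<lambda>_. 2::nat"
        "\<lambda>l. if j div 4 ^ l mod 4 = 0 \<or> j div 4 ^ l mod 4 = 3 then 2 else 3"] by simp
  then show "2 ^ n \<le> y" if "y \<in> {sqpt_cost n i j | i j. i < 4 ^ n \<and> j < 4 ^ n}" for y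
    using that by blast
  \<comment> \<open>All digits of column 0 are 0, and each contributes a factor 2.\<close>
  have "sqpt_cost n 0 0 = 2 ^ n" by (simp add: sqpt_cost_eq)
  then show "2 ^ n \<in> {sqpt_cost n i j | i j. i < 4 ^ n \<and> j < 4 ^ n}"
    by (metis (mono_tags, lifting) mem_Collect_eq zero_less_numeral zero_less_power)
qed

lemma Max_sqpt_cost: "Max {sqpt_cost n i j | i j. i < 4 ^ n \<and> j < 4 ^ n} = 3 ^ n"
proof (rule Max_eqI)
  show "finite {sqpt_cost n i j | i j. i < 4 ^ n \<and> j < 4 ^ n}"
    by (rule finite_image_set2) auto
  have "sqpt_cost n i j \<le> 3 ^ n" if "j < 4 ^ n" for i j
    unfolding sqpt_cost_eq[OF that]
    using prod_mono[of "{..<n}" "\<lambda>l. if j div 4 ^ l mod 4 = 0 \<or> j div 4 ^ l mod 4 = 3 then 2 else 3"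
        "\<lambda>_. 3::nat"] by simp
  then show "y \<le> 3 ^ n" if "y \<in> {sqpt_cost n i j | i j. i < 4 ^ n \<and> j < 4 ^ n}" for y
    using that by blast
  obtain j :: nat where j: "j < 4 ^ n" "\<forall>l<n. j div 4 ^ l mod 4 = 1"
    using ex_all_digits_1 by blast
  then have "sqpt_cost n j j = 3 ^ n" by (simp add: sqpt_cost_eq)
  then show "3 ^ n \<in> {sqpt_cost n i j | i j. i < 4 ^ n \<and> j < 4 ^ n}"
    using j(1) by (metis (mono_tags, lifting) mem_Collect_eq)
qed

lemma Max_dptm_cost:
  assumes "n \<ge> 1"
  shows "Max {dptm_cost n i j | i j. i < 4 ^ n \<and> j < 4 ^ n} = 2"
proof (rule Max_eqI)
  show "finite {dptm_cost n i j | i j. i < 4 ^ n \<and> j < 4 ^ n}"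
    by (rule finite_image_set2) auto
  show "y \<le> 2" if "y \<in> {dptm_cost n i j | i j. i < 4 ^ n \<and> j < 4 ^ n}" for y
    using that by (auto simp: dptm_cost_eq)
  \<comment> \<open>Column 1 exists because \<open>n\<close> is positive; for \<open>n = 0\<close>
    the only index would be 0, of cost 1.\<close>
  have 1: "1 < (4::nat) ^ n" using assms by (intro one_less_power) auto
  then have "dptm_cost n 1 1 = 2" by (simp add: dptm_cost_eq)
  then show "2 \<in> {dptm_cost n i j | i j. i < 4 ^ n \<and> j < 4 ^ n}"
    using 1 by (metis (mono_tags, lifting) mem_Collect_eq)
qed

theorem theorem1:
  fixes n d :: nat
    and \<Phi> :: "complex mat \<Rightarrow> complex mat"
    and \<Gamma> :: "complex mat"
  assumes "n \<ge> 1"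
    and "d = 2 ^ n"
    and "quantum_channel d \<Phi>"
    and "\<Gamma> = ptm n \<Phi>"
  shows
    "Max {dptm_cost n i j | i j. i < d\<^sup>2 \<and> j < d\<^sup>2} \<le> Min {sqpt_cost n i j | i j. i < d\<^sup>2 \<and> j < d\<^sup>2}
     \<and> Min {sqpt_cost n i j | i j. i < d\<^sup>2 \<and> j < d\<^sup>2} < Max {sqpt_cost n i j | i j. i < d\<^sup>2 \<and> j < d\<^sup>2}
     \<and> (Max {dptm_cost n i j | i j. i < d\<^sup>2 \<and> j < d\<^sup>2} = Min {sqpt_cost n i j | i j. i < d\<^sup>2 \<and> j < d\<^sup>2}
          \<longleftrightarrow> n = 1)
     \<and> (\<forall>i<d\<^sup>2. \<forall>j<d\<^sup>2. dptm_cost n i j = (if j = 0 then 1 else 2))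
     \<and> Min {sqpt_cost n i j | i j. i < d\<^sup>2 \<and> j < d\<^sup>2} = 2 ^ n
     \<and> Max {sqpt_cost n i j | i j. i < d\<^sup>2 \<and> j < d\<^sup>2} = 3 ^ n"
proof -
  have d: "d\<^sup>2 = 4 ^ n" using assms(2) by (simp add: square_power_2)
  have "(2::nat) ^ 1 \<le> 2 ^ n" using assms(1) by (rule power_increasing) simp
  moreover have "(2::nat) ^ n < 3 ^ n" using assms(1) by (intro power_strict_mono) auto
  \<comment> \<open>The DPTM maximum 2 is read as \<open>2 ^ 1\<close>, and injectivity of the
    exponent settles when equality holds.\<close>
  moreover have "(2::nat) = 2 ^ n \<longleftrightarrow> n = 1"
    using power_inject_exp[of "2::nat" 1 n] by auto
  ultimately show ?thesis
    unfolding d Min_sqpt_cost Max_sqpt_cost Max_dptm_cost[OF assms(1)]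
    by (simp add: dptm_cost_eq)
qed

end
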